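(* Let $\ell,m,n$ be positive integers with $\ell\ge 2n$. Let $f:N\to U$ be a $C^2$ immersion of a $C^2$ manifold $N$ of dimension $n$ into an open subset $U$ of $\mathbb{R}^m$. Let $F:U\to\mathbb{R}^\ell$ be a $C^2$ mapping. Then there exists a subset $\Sigma$ of $\mathcal{L}(\mathbb{R}^m,\mathbb{R}^\ell)$ with Lebesgue measure zero such that for any $\pi\in\mathcal{L}(\mathbb{R}^m,\mathbb{R}^\ell)-\Sigma$, the mapping $F_\pi\circ f:N\to\mathbb{R}^\ell$ is a $C^2$ immersion.
   Context: All manifolds are without boundary and have countable bases. $\mathcal{L}(\mathbb{R}^m,\mathbb{R}^\ell)$ is the space of all linear mappings $\mathbb{R}^m\to\mathbb{R}^\ell$, naturally identified with $(\mathbb{R}^m)^\ell$, which gives the meaning of Lebesgue measure zero. For $\pi\in\mathcal{L}(\mathbb{R}^m,\mathbb{R}^\ell)$, $F_\pi=F+\pi|_U:U\to\mathbb{R}^\ell$. *)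

theory Defs
  imports "HOL-Analysis.Analysis"
begin

text \<open>\<open>C\<^sup>2\<close> maps between Euclidean spaces; only used for open \<open>S\<close>.\<close>

definition C2_on :: "'a::euclidean_space set \<Rightarrow> ('a \<Rightarrow> 'b::euclidean_space) \<Rightarrow> bool" where
  "C2_on S f \<longleftrightarrow>
    (\<exists>(f' :: 'a \<Rightarrow> 'a \<Rightarrow>\<^sub>L 'b) (f'' :: 'a \<Rightarrow> 'a \<Rightarrow>\<^sub>L ('a \<Rightarrow>\<^sub>L 'b)).
      (\<forall>x\<in>S. (f has_derivative blinfun_apply (f' x)) (at x)) \<and>
      (\<forall>x\<in>S. (f' has_derivative blinfun_apply (f'' x)) (at x)) \<and>
      continuous_on S f'')"

text \<open>A chart is a pair \<open>(V, \<phi>)\<close>; the values of \<open>\<phi>\<close> outside \<open>V\<close> carry no meaning, and the inverse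
  chart \<open>\<phi> ` V \<rightarrow> V\<close> is \<open>inv_into V \<phi>\<close>.\<close>

type_synonym ('a, 'e) chart = "'a set \<times> ('a \<Rightarrow> 'e)"

definition is_chart :: "'a topology \<Rightarrow> ('a, 'e::euclidean_space) chart \<Rightarrow> bool" where
  "is_chart N c \<longleftrightarrow> (case c of (V, \<phi>) \<Rightarrow>
    openin N V \<and> open (\<phi> ` V) \<and>
    homeomorphic_map (subtopology N V) (top_of_set (\<phi> ` V)) \<phi>)"

definition C2_atlas :: "'a topology \<Rightarrow> ('a, 'e::euclidean_space) chart set \<Rightarrow> bool" where
  "C2_atlas N A \<longleftrightarrow>
    (\<forall>c\<in>A. is_chart N c) \<and>
    (\<Union>(V, \<phi>)\<in>A. V) = topspace N \<and>
    (\<forall>(V, \<phi>)\<in>A. \<forall>(W, \<psi>)\<in>A. C2_on (\<phi> ` (V \<inter> W)) (\<psi> \<circ> inv_into V \<phi>))"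

text \<open>The atlas is not required to be maximal: every atlas determines a unique maximal one, and the
  notions below do not depend on which atlas of the \<open>C\<^sup>2\<close> structure is used. The dimension of the
  manifold is \<open>DIM('e)\<close>.\<close>

definition C2_manifold :: "'a topology \<Rightarrow> ('a, 'e::euclidean_space) chart set \<Rightarrow> bool" where
  "C2_manifold N A \<longleftrightarrow> Hausdorff_space N \<and> second_countable N \<and> C2_atlas N A"

definition C2_map ::
  "('a, 'e::euclidean_space) chart set \<Rightarrow> ('a \<Rightarrow> 'b::euclidean_space) \<Rightarrow> bool" where
  "C2_map A f \<longleftrightarrow> (\<forall>(V, \<phi>)\<in>A. C2_on (\<phi> ` V) (f \<circ> inv_into V \<phi>))"

text \<open>Charts identify the tangent spaces of the manifold with \<open>'e\<close>, so injectivity of the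
  differential of \<open>f\<close> at \<open>p\<close> is that of the derivative of \<open>f \<circ> \<phi>\<inverse>\<close> at \<open>\<phi> p\<close>. A map into an open
  subset of \<open>'b\<close> is an immersion iff it is one as a map into \<open>'b\<close>.\<close>

definition C2_immersion ::
  "('a, 'e::euclidean_space) chart set \<Rightarrow> ('a \<Rightarrow> 'b::euclidean_space) \<Rightarrow> bool" where
  "C2_immersion A f \<longleftrightarrow> C2_map A f \<and>
    (\<forall>(V, \<phi>)\<in>A. \<forall>p\<in>V. inj (frechet_derivative (f \<circ> inv_into V \<phi>) (at (\<phi> p))))"

text \<open>\<open>matrix\<close> identifies the linear maps \<open>real^'m \<Rightarrow> real^'l\<close> with \<open>(real^'m)^'l\<close>: the \<open>i\<close>-th row
  represents the \<open>i\<close>-th component.\<close>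

definition linear_maps_null :: "(real^'m \<Rightarrow> real^'l) set \<Rightarrow> bool" where
  "linear_maps_null \<Sigma> \<longleftrightarrow>
    \<Sigma> \<subseteq> {\<pi>. linear \<pi>} \<and> matrix ` \<Sigma> \<in> null_sets (lebesgue :: (real^'m^'l) measure)"

end

theory Submission
  imports Defs
begin

text \<open>In a chart write \<open>g\<close> for the immersion and \<open>h\<close> for
  \<open>F \<circ> g\<close>. Perturbing \<open>F\<close> by a matrix \<open>M\<close> gives
  \<open>h\<close> + \<open>M g\<close> with derivative \<open>h' x + M g' x\<close>, and this fails
  to be injective iff \<open>M (g' x v) = - h' x v\<close> for some \<open>v \<noteq> 0\<close>.
  Since \<open>g' x\<close> is injective, \<open>g' x v \<noteq> 0\<close>, so for fixed
  \<open>x\<close> and \<open>v\<close> this is a system of l independent affine equations on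
  \<open>M\<close>. The point \<open>x\<close> and the line through \<open>v\<close> range over only
  2n - 1 < l parameters, so the bad matrices form a differentiable image of something of dimension
  below ml, hence a null set. This is \<open>negligible_noninjective_perturbations\<close>; C^2
  regularity enters because \<open>g'\<close> and \<open>h'\<close> must be differentiable.

  Countably many charts cover the manifold, and the union of their null sets is the exceptional set.
  By \<open>inj_frechet_derivative_chart_change\<close>, injectivity checked in these charts holds
  in every chart of the atlas.\<close>

section \<open>Calculus of C^2 maps\<close>

lemma C2_on_add:
  assumes "C2_on S f" "C2_on S g"
  shows "C2_on S (\<lambda>x. f x + g x)"
proof -
  obtain f' f'' where f: "\<And>x. x \<in> S \<Longrightarrow> (f has_derivative blinfun_apply (f' x)) (at x)"
      "\<And>x. x \<in> S \<Longrightarrow> (f' has_derivative blinfun_apply (f'' x)) (at x)" "continuous_on S f''"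
    using assms(1) unfolding C2_on_def by metis
  obtain g' g'' where g: "\<And>x. x \<in> S \<Longrightarrow> (g has_derivative blinfun_apply (g' x)) (at x)"
      "\<And>x. x \<in> S \<Longrightarrow> (g' has_derivative blinfun_apply (g'' x)) (at x)" "continuous_on S g''"
    using assms(2) unfolding C2_on_def by metis
  show ?thesis
    unfolding C2_on_def
  proof (intro exI conjI ballI)
    fix x assume x: "x \<in> S"
    show "((\<lambda>x. f x + g x) has_derivative blinfun_apply (f' x + g' x)) (at x)"
      using has_derivative_add[OF f(1) g(1), OF x x] by (simp add: plus_blinfun.rep_eq)
    show "((\<lambda>x. f' x + g' x) has_derivative blinfun_apply (f'' x + g'' x)) (at x)"
      using has_derivative_add[OF f(2) g(2), OF x x] by (simp add: plus_blinfun.rep_eq)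
  qed (intro continuous_intros f g)
qed

lemma C2_on_linear:
  fixes \<pi> :: "'a::euclidean_space \<Rightarrow> 'b::euclidean_space"
  assumes "linear \<pi>"
  shows "C2_on S \<pi>"
  unfolding C2_on_def
proof (intro exI conjI ballI)
  fix x
  show "(\<pi> has_derivative blinfun_apply (Blinfun \<pi>)) (at x)"
    using assms by (simp add: bounded_linear_Blinfun_apply linear_conv_bounded_linear
        bounded_linear_imp_has_derivative)
  show "((\<lambda>x. Blinfun \<pi>) has_derivative blinfun_apply ((\<lambda>x. 0) x)) (at x)"
    by (simp add: zero_blinfun.rep_eq)
qed auto

lemma C2_on_compose:
  fixes g :: "'a::euclidean_space \<Rightarrow> 'b::euclidean_space"
    and f :: "'b \<Rightarrow> 'c::euclidean_space"
  assumes "C2_on T f" "C2_on S g" "g ` S \<subseteq> T"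
  shows "C2_on S (f \<circ> g)"
proof -
  obtain f' f'' where f: "\<And>x. x \<in> T \<Longrightarrow> (f has_derivative blinfun_apply (f' x)) (at x)"
      "\<And>x. x \<in> T \<Longrightarrow> (f' has_derivative blinfun_apply (f'' x)) (at x)" "continuous_on T f''"
    using assms(1) unfolding C2_on_def by metis
  obtain g' g'' where g: "\<And>x. x \<in> S \<Longrightarrow> (g has_derivative blinfun_apply (g' x)) (at x)"
      "\<And>x. x \<in> S \<Longrightarrow> (g' has_derivative blinfun_apply (g'' x)) (at x)" "continuous_on S g''"
    using assms(2) unfolding C2_on_def by metis
  \<comment> \<open>The product rule applied to the first derivative
    \<open>f' (g x) o\<^sub>L g' x\<close> of the composite.\<close>
  define D where "D x v = (f' (g x) o\<^sub>L g'' x v) + (f'' (g x) (g' x v) o\<^sub>L g' x)" for x v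
  have D: "bounded_linear (D x)" for x
    unfolding D_def
    by (intro bounded_linear_add
        bounded_linear_compose[OF bounded_bilinear.bounded_linear_right[OF bounded_bilinear_blinfun_compose]]
        bounded_linear_compose[OF bounded_bilinear.bounded_linear_left[OF bounded_bilinear_blinfun_compose]]
        bounded_linear_compose[OF blinfun.bounded_linear_right] blinfun.bounded_linear_right)
  have cont_g: "continuous_on S g" and cont_g': "continuous_on S g'"
    using g(1,2) by (meson differentiable_def differentiable_imp_continuous_within
        continuous_at_imp_continuous_on)+
  have "continuous_on T f'"
    using f(2) by (meson differentiable_def differentiable_imp_continuous_within
        continuous_at_imp_continuous_on)
  then have cont_f': "continuous_on S (\<lambda>x. f' (g x))"
    using cont_g assms(3) by (rule continuous_on_compose2)
  have cont_f'': "continuous_on S (\<lambda>x. f'' (g x))"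
    using f(3) cont_g assms(3) by (rule continuous_on_compose2)
  show ?thesis
    unfolding C2_on_def
  proof (intro exI conjI ballI)
    fix x assume x: "x \<in> S"
    then have gx: "g x \<in> T" using assms(3) by auto
    show "(f \<circ> g has_derivative blinfun_apply (f' (g x) o\<^sub>L g' x)) (at x)"
      using diff_chain_at[OF g(1)[OF x] f(1)[OF gx]] by (simp add: blinfun_compose.rep_eq)
    have "((\<lambda>x. f' (g x)) has_derivative (\<lambda>v. f'' (g x) (g' x v))) (at x)"
      using diff_chain_at[OF g(1)[OF x] f(2)[OF gx]] by (simp add: o_def)
    from bounded_bilinear.FDERIV[OF bounded_bilinear_blinfun_compose this g(2)[OF x]]
    show "((\<lambda>x. f' (g x) o\<^sub>L g' x) has_derivative blinfun_apply (Blinfun (D x))) (at x)"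
      unfolding bounded_linear_Blinfun_apply[OF D] unfolding D_def .
  next
    show "continuous_on S (\<lambda>x. Blinfun (D x))"
    \<comment> \<open>In finite dimension, continuity in operator norm can be tested on single
      vectors, where the formula for \<open>D\<close> is explicit.\<close>
    proof (rule continuous_on_blinfun_componentwise)
      fix i :: 'a
      show "continuous_on S (\<lambda>x. Blinfun (D x) i)"
        unfolding bounded_linear_Blinfun_apply[OF D] D_def
        by (intro continuous_intros cont_f' cont_f'' g cont_g'
            bounded_bilinear.continuous_on[OF bounded_bilinear_blinfun_compose])
    qed
  qed
qed

section \<open>The null set of bad matrices\<close>

lemma differentiable_blinfun_apply:
  assumes "f differentiable (at x within S)" "g differentiable (at x within S)"
  shows "(\<lambda>x. blinfun_apply (f x) (g x)) differentiable (at x within S)"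
proof -
  obtain f' g' where "(f has_derivative f') (at x within S)" "(g has_derivative g') (at x within S)"
    using assms by (auto simp: differentiable_def)
  then show ?thesis
    using bounded_bilinear.FDERIV[OF bounded_bilinear_blinfun_apply] differentiable_def by blast
qed

text \<open>A matrix is bad at \<open>x\<close> if it satisfies the linear system \<open>M (g' x v) = - h' x v\<close> for some \<open>v \<noteq> 0\<close>.
  Normalising \<open>v $ j = 1\<close> and solving for the column \<open>k\<close> with \<open>(g' x v) $ k \<noteq> 0\<close>, \<open>M\<close> is a differentiable
  function of \<open>x\<close>, \<open>v\<close> and its remaining columns. As \<open>2 * CARD('n) \<le> CARD('l)\<close>, the pair \<open>(x, v)\<close>
  can be stored in the redundant column \<open>k\<close>, so that the parameters form part of a hyperplane in the space
  of matrices itself.\<close>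

lemma negligible_noninjective_perturbations:
  fixes g' :: "real^'n \<Rightarrow> (real^'n) \<Rightarrow>\<^sub>L (real^'m)" and h' :: "real^'n \<Rightarrow> (real^'n) \<Rightarrow>\<^sub>L (real^'l)"
  assumes card: "2 * CARD('n) \<le> CARD('l)"
    and g': "\<And>x. x \<in> S \<Longrightarrow> g' differentiable (at x)"
    and h': "\<And>x. x \<in> S \<Longrightarrow> h' differentiable (at x)"
    and inj: "\<And>x. x \<in> S \<Longrightarrow> inj (blinfun_apply (g' x))"
  shows "negligible {M :: real^'m^'l. \<exists>x\<in>S. \<not> inj (\<lambda>v. h' x v + M *v g' x v)}"
proof -
  have "card (UNIV :: ('n + 'n) set) \<le> CARD('l)"
    using card by (simp add: UNIV_Plus_UNIV[symmetric] card_Plus del: UNIV_Plus_UNIV)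
  \<comment> \<open>Row indices are reserved here: rows \<open>e (Inl b)\<close> will store the
    coordinates of \<open>x\<close>, rows \<open>e (Inr b)\<close> those of \<open>v\<close>. The
    hypothesis on dimensions provides the room.\<close>
  then obtain e :: "'n + 'n \<Rightarrow> 'l" where e: "inj e"
    by (metis card_le_inj finite)
  \<comment> \<open>\<open>X k\<close> and \<open>Y k\<close> decode \<open>x\<close> and
    \<open>v\<close> from column \<open>k\<close>; \<open>w\<close> and \<open>z\<close> are then
    the vectors \<open>g' x v\<close> and \<open>h' x v\<close>.\<close>
  define X :: "'m \<Rightarrow> real^'m^'l \<Rightarrow> real^'n" where "X k M = (\<chi> b. M $ e (Inl b) $ k)" for k M
  define Y :: "'m \<Rightarrow> real^'m^'l \<Rightarrow> real^'n" where "Y k M = (\<chi> b. M $ e (Inr b) $ k)" for k M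
  define w where "w k M = blinfun_apply (g' (X k M)) (Y k M)" for k M
  define z where "z k M = blinfun_apply (h' (X k M)) (Y k M)" for k M
  \<comment> \<open>Column \<open>k\<close>, which only carries parameters, is replaced by the
    unique one for which the resulting matrix maps \<open>w\<close> to \<open>- z\<close>.\<close>
  define \<Phi> :: "'m \<Rightarrow> real^'m^'l \<Rightarrow> real^'m^'l" where
    "\<Phi> k M = (\<chi> a i. if i = k
       then (- z k M $ a - (\<Sum>i\<in>UNIV - {k}. M $ a $ i * w k M $ i)) / w k M $ k
       else M $ a $ i)" for k M
  \<comment> \<open>The last condition is the normalisation \<open>v $ j = 1\<close> on the decoded
    \<open>v\<close>; it confines \<open>H j k\<close> to a coordinate hyperplane.\<close>
  define H where "H j k = {M. X k M \<in> S \<and> w k M $ k \<noteq> 0 \<and> M $ e (Inr j) $ k = 1}" for j k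
  have "linear (X k)" "linear (Y k)" for k
    by (auto simp: X_def Y_def linear_iff vec_eq_iff)
  then have X: "X k differentiable (at M)" and Y: "Y k differentiable (at M)" for k M
    by (simp_all add: linear_imp_differentiable)
  have entry: "(\<lambda>M :: real^'m^'l. M $ a $ i) differentiable (at M)" for a i M
    by (rule linear_imp_differentiable) (simp add: linear_iff)
  have w: "w k differentiable (at M)" and z: "z k differentiable (at M)" if "M \<in> H j k" for j k M
  proof -
    have "X k M \<in> S" using that by (simp add: H_def)
    then have "(\<lambda>M. g' (X k M)) differentiable (at M)" "(\<lambda>M. h' (X k M)) differentiable (at M)"
      using differentiable_chain_at[OF X g'] differentiable_chain_at[OF X h'] by (auto simp: o_def)
    then show "w k differentiable (at M)" "z k differentiable (at M)"
      unfolding w_def z_def using Y by (auto intro: differentiable_blinfun_apply)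
  qed
  have vec_nth: "(\<lambda>x. u x $ i) differentiable F" if "u differentiable F" for u :: "'x::real_normed_vector \<Rightarrow> real^'y" and i F
    using that unfolding differentiable_def
    by (blast intro: bounded_linear.has_derivative[OF bounded_linear_vec_nth])
  have vecI: "u differentiable (at M)" if "\<And>a i. (\<lambda>M. u M $ a $ i) differentiable (at M)"
    for u :: "real^'m^'l \<Rightarrow> real^'m^'l" and M
    using that by (subst differentiable_componentwise_within) (auto simp: Basis_vec_def inner_axis)
  have "\<Phi> k differentiable (at M)" if M: "M \<in> H j k" for j k M
  proof (rule vecI)
    fix a i
    show "(\<lambda>M. \<Phi> k M $ a $ i) differentiable at M"
    proof (cases "i = k")
      case True
      have "w k M $ k \<noteq> 0" using M by (simp add: H_def)
      then show ?thesis
        using True w[OF M] z[OF M]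
        by (auto simp: \<Phi>_def intro!: derivative_intros differentiable_divide differentiable_sum
            differentiable_diff differentiable_minus differentiable_mult vec_nth entry)
    next
      case False
      then show ?thesis by (simp add: \<Phi>_def entry)
    qed
  qed
  then have diff: "\<Phi> k differentiable_on H j k" for j k
    by (simp add: differentiable_on_def differentiable_at_withinI)
  have "negligible {M :: real^'m^'l. M \<bullet> axis (e (Inr j)) (axis k 1) = 1}" for j k
    by (intro negligible_standard_hyperplane) (auto simp: Basis_vec_def)
  then have "negligible (H j k)" for j k
    by (rule negligible_subset) (auto simp: H_def inner_axis)
  \<comment> \<open>Differentiable maps of the matrix space into itself preserve null sets, and
    there are finitely many pairs of indices.\<close>
  then have "negligible (\<Union>j. \<Union>k. \<Phi> k ` H j k)"
    by (intro negligible_Union) 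
      (auto intro!: negligible_Union negligible_differentiable_image_negligible diff)
  moreover have "{M :: real^'m^'l. \<exists>x\<in>S. \<not> inj (\<lambda>v. h' x v + M *v g' x v)} \<subseteq> (\<Union>j. \<Union>k. \<Phi> k ` H j k)"
  proof clarify
    fix M :: "real^'m^'l" and x
    assume x: "x \<in> S" and "\<not> inj (\<lambda>v. h' x v + M *v g' x v)"
    moreover have lin: "linear (\<lambda>v. h' x v + M *v g' x v)"
      by (intro linear_compose_add bounded_linear.linear[OF blinfun.bounded_linear_right]
          linear_compose[unfolded o_def, OF bounded_linear.linear[OF blinfun.bounded_linear_right]]
          matrix_vector_mul_linear)
    ultimately obtain u where u: "u \<noteq> 0" "h' x u + M *v g' x u = 0"
      by (meson linear_injective_0)
    then obtain j where j: "u $ j \<noteq> 0" by (auto simp: vec_eq_iff)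
    \<comment> \<open>The kernel condition is homogeneous, so a kernel vector may be rescaled to
      \<open>v $ j = 1\<close>.\<close>
    define v where "v = (1 / u $ j) *\<^sub>R u"
    have vj: "v $ j = 1" using j by (simp add: v_def)
    have v: "h' x v + M *v g' x v = 0"
      unfolding v_def using linear_scale[OF lin, of "1 / u $ j" u] u(2) by simp
    have "g' x v \<noteq> 0"
      using inj[OF x] vj by (metis blinfun.zero_right injD zero_index zero_neq_one)
    then obtain k where k: "g' x v $ k \<noteq> 0" by (auto simp: vec_eq_iff)
    \<comment> \<open>The preimage of \<open>M\<close>: its column \<open>k\<close> is overwritten
      by the code of \<open>x\<close> and \<open>v\<close>. Rows outside the range of
      \<open>e\<close> get arbitrary values there, which are neither decoded nor kept by
      \<open>\<Phi> k\<close>.\<close>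
    define P :: "real^'m^'l" where "P = (\<chi> a i. if i = k
      then (if a \<in> range (e \<circ> Inl) then x $ inv (e \<circ> Inl) a else v $ inv (e \<circ> Inr) a) else M $ a $ i)"
    have eL: "inj (e \<circ> Inl)" and eR: "inj (e \<circ> Inr)"
      using e by (auto intro: inj_compose)
    have XP: "X k P = x"
      using inv_f_f[OF eL] by (simp add: X_def P_def vec_eq_iff)
    have "e (Inr b) \<notin> range (e \<circ> Inl)" for b
      using e by (auto dest: injD)
    then have YP: "Y k P = v"
      using inv_f_f[OF eR] by (simp add: Y_def P_def vec_eq_iff)
    have "P \<in> H j k"
    proof -
      have "P $ e (Inr j) $ k = Y k P $ j" by (simp add: Y_def)
      then show ?thesis using x k vj by (simp add: H_def w_def XP YP)
    qed
    moreover have "\<Phi> k P = M"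
    proof -
      \<comment> \<open>Row \<open>a\<close> of the kernel equation, solved for the term of column
        \<open>k\<close>: the overwritten column is recovered from the others.\<close>
      have "- h' x v $ a - (\<Sum>i\<in>UNIV - {k}. M $ a $ i * g' x v $ i) = M $ a $ k * g' x v $ k" for a
      proof -
        have "h' x v $ a + (\<Sum>i\<in>UNIV. M $ a $ i * g' x v $ i) = 0"
          using arg_cong[OF v, of "\<lambda>y. y $ a"] by (simp add: matrix_vector_mult_def)
        then show ?thesis by (subst (asm) sum.remove[of _ k]) auto
      qed
      moreover have "(\<Sum>i\<in>UNIV - {k}. P $ a $ i * g' x v $ i) = (\<Sum>i\<in>UNIV - {k}. M $ a $ i * g' x v $ i)" for a
        by (rule sum.cong) (auto simp: P_def)
      ultimately show ?thesis
        using k by (auto simp: \<Phi>_def vec_eq_iff w_def z_def XP YP) (auto simp: P_def)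
    qed
    ultimately show "M \<in> (\<Union>j. \<Union>k. \<Phi> k ` H j k)" by blast
  qed
  ultimately show ?thesis by (rule negligible_subset)
qed

section \<open>Charts and change of charts\<close>

lemma is_chart_inv_into:
  assumes "is_chart N (V, \<phi>)" "p \<in> V"
  shows "inv_into V \<phi> (\<phi> p) = p"
proof -
  have "inj_on \<phi> V"
    using assms(1) homeomorphic_imp_injective_map openin_subset
    by (fastforce simp: is_chart_def Int_absorb1)
  then show ?thesis using assms(2) by simp
qed

lemma is_chart_open_image:
  assumes "is_chart N (V, \<phi>)" "openin N W"
  shows "open (\<phi> ` (V \<inter> W))"
proof -
  have "openin (subtopology N V) (V \<inter> W)"
    using assms(2) by (simp add: openin_subtopology_Int2)
  then have "openin (top_of_set (\<phi> ` V)) (\<phi> ` (V \<inter> W))"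
    using assms(1) homeomorphic_imp_open_map open_map_def by (fastforce simp: is_chart_def)
  then show ?thesis
    using assms(1) openin_open_eq by (auto simp: is_chart_def)
qed

lemma C2_on_imp_differentiable:
  assumes "C2_on S f" "x \<in> S"
  shows "f differentiable (at x)"
  using assms unfolding C2_on_def differentiable_def by blast

text \<open>The derivative of the transition map has a left inverse, namely the derivative of the
  reverse transition, so it is injective; the chain rule then transfers injectivity between charts.
  This allows the exceptional set to be built from a countable subatlas.\<close>

lemma inj_frechet_derivative_chart_change:
  fixes G :: "'a \<Rightarrow> 'b::euclidean_space"
    and N :: "'a topology" and A :: "('a, 'e::euclidean_space) chart set"
  assumes A: "C2_atlas N A" "C2_map A G" "(V, \<phi>) \<in> A" "(W, \<psi>) \<in> A"
    and p: "p \<in> V" "p \<in> W"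
    and inj: "inj (frechet_derivative (G \<circ> inv_into W \<psi>) (at (\<psi> p)))"
  shows "inj (frechet_derivative (G \<circ> inv_into V \<phi>) (at (\<phi> p)))"
proof -
  have V: "is_chart N (V, \<phi>)" and W: "is_chart N (W, \<psi>)"
    using A by (auto simp: C2_atlas_def)
  define \<tau> where "\<tau> = \<psi> \<circ> inv_into V \<phi>"
  define \<sigma> where "\<sigma> = \<phi> \<circ> inv_into W \<psi>"
  have "C2_on (\<phi> ` (V \<inter> W)) \<tau>" "C2_on (\<psi> ` (W \<inter> V)) \<sigma>"
    using A unfolding C2_atlas_def \<tau>_def \<sigma>_def by fast+
  then have "\<tau> differentiable (at (\<phi> p))" "\<sigma> differentiable (at (\<psi> p))"
    using p by (auto intro: C2_on_imp_differentiable)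
  then obtain \<tau>' \<sigma>' where \<tau>': "(\<tau> has_derivative \<tau>') (at (\<phi> p))"
      and \<sigma>': "(\<sigma> has_derivative \<sigma>') (at (\<psi> p))"
    by (auto simp: differentiable_def)
  have open_VW: "open (\<phi> ` (V \<inter> W))"
    using V W by (auto intro: is_chart_open_image simp: is_chart_def)
  have pVW: "\<phi> p \<in> \<phi> ` (V \<inter> W)" using p by auto
  have \<tau>p: "\<tau> (\<phi> p) = \<psi> p"
    using p is_chart_inv_into[OF V] by (simp add: \<tau>_def)
  have "(\<sigma> \<circ> \<tau> has_derivative \<sigma>' \<circ> \<tau>') (at (\<phi> p))"
    using \<tau>' \<sigma>' by (auto intro: diff_chain_at simp: \<tau>p)
  then have "((\<lambda>x. x) has_derivative \<sigma>' \<circ> \<tau>') (at (\<phi> p))"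
    using open_VW pVW
    by (rule has_derivative_transform_within_open)
      (auto simp: \<sigma>_def \<tau>_def is_chart_inv_into[OF V] is_chart_inv_into[OF W])
  then have "\<sigma>' \<circ> \<tau>' = (\<lambda>x. x)"
    using has_derivative_unique has_derivative_ident by blast
  then have inj_\<tau>': "inj \<tau>'"
    by (metis comp_apply injI)
  have "G \<circ> inv_into W \<psi> differentiable (at (\<psi> p))"
    using A p by (fastforce simp: C2_map_def intro: C2_on_imp_differentiable)
  then have D: "(G \<circ> inv_into W \<psi> has_derivative frechet_derivative (G \<circ> inv_into W \<psi>) (at (\<psi> p))) (at (\<psi> p))"
    by (simp add: frechet_derivative_works)
  have "(G \<circ> inv_into W \<psi> \<circ> \<tau> has_derivative frechet_derivative (G \<circ> inv_into W \<psi>) (at (\<psi> p)) \<circ> \<tau>') (at (\<phi> p))"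
    using \<tau>' D by (auto intro: diff_chain_at simp: \<tau>p)
  \<comment> \<open>The two expressions of \<open>G\<close> agree on the open image of the overlap,
    which suffices for the derivative at \<open>\<phi> p\<close>.\<close>
  then have "(G \<circ> inv_into V \<phi> has_derivative frechet_derivative (G \<circ> inv_into W \<psi>) (at (\<psi> p)) \<circ> \<tau>') (at (\<phi> p))"
    using open_VW pVW
    by (rule has_derivative_transform_within_open)
      (auto simp: \<tau>_def is_chart_inv_into[OF V] is_chart_inv_into[OF W])
  then have "frechet_derivative (G \<circ> inv_into V \<phi>) (at (\<phi> p))
      = frechet_derivative (G \<circ> inv_into W \<psi>) (at (\<psi> p)) \<circ> \<tau>'"
    by (metis frechet_derivative_at)
  then show ?thesis
    using inj inj_\<tau>' by (simp add: inj_compose)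
qed

section \<open>From one chart to the manifold\<close>

text \<open>The case of a single chart, with \<open>g\<close> the immersion in coordinates. Matrix
  multiplication is its own derivative, so the question reduces to the linear systems treated
  above.\<close>

lemma negligible_non_immersive_perturbations:
  fixes F :: "real^'m \<Rightarrow> real^'l" and g :: "real^'n \<Rightarrow> real^'m"
  assumes card: "2 * CARD('n) \<le> CARD('l)"
    and F: "C2_on U F" and g: "C2_on S g" and gU: "g ` S \<subseteq> U"
    and inj: "\<And>x. x \<in> S \<Longrightarrow> inj (frechet_derivative g (at x))"
  shows "negligible {M :: real^'m^'l.
    \<exists>x\<in>S. \<not> inj (frechet_derivative ((\<lambda>y. F y + M *v y) \<circ> g) (at x))}"
proof -
  obtain g' g'' where g': "\<And>x. x \<in> S \<Longrightarrow> (g has_derivative blinfun_apply (g' x)) (at x)"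
      "\<And>x. x \<in> S \<Longrightarrow> (g' has_derivative blinfun_apply (g'' x)) (at x)"
    using g unfolding C2_on_def by metis
  obtain h' h'' where h': "\<And>x. x \<in> S \<Longrightarrow> (F \<circ> g has_derivative blinfun_apply (h' x)) (at x)"
      "\<And>x. x \<in> S \<Longrightarrow> (h' has_derivative blinfun_apply (h'' x)) (at x)"
    using C2_on_compose[OF F g gU] unfolding C2_on_def by metis
  have "frechet_derivative ((\<lambda>y. F y + M *v y) \<circ> g) (at x) = (\<lambda>v. h' x v + M *v g' x v)"
    if x: "x \<in> S" for x and M :: "real^'m^'l"
  proof -
    have "((\<lambda>y. F y + M *v y) \<circ> g has_derivative (\<lambda>v. h' x v + M *v g' x v)) (at x)"
      using has_derivative_add[OF h'(1)[OF x]
          bounded_linear.has_derivative[OF matrix_vector_mul_bounded_linear g'(1)[OF x]], of M]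
      by (simp add: o_def)
    then show ?thesis by (rule frechet_derivative_at[symmetric])
  qed
  moreover have "inj (blinfun_apply (g' x))" if "x \<in> S" for x
    using inj[OF that] frechet_derivative_at[OF g'(1)[OF that]] by simp
  then have "negligible {M :: real^'m^'l. \<exists>x\<in>S. \<not> inj (\<lambda>v. h' x v + M *v g' x v)}"
    using g'(2) h'(2) by (intro negligible_noninjective_perturbations card) (auto simp: differentiable_def)
  ultimately show ?thesis by (simp cong: bex_cong)
qed

theorem corollary2:
  fixes N :: "'a topology"
    and A :: "('a, real^'n) chart set"
    and f :: "'a \<Rightarrow> real^'m"
    and U :: "(real^'m) set"
    and F :: "real^'m \<Rightarrow> real^'l"
  assumes "CARD('l) \<ge> 2 * CARD('n)"
    and "C2_manifold N A"
    and "open U"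
    and "f \<in> topspace N \<rightarrow> U"
    and "C2_immersion A f"
    and "C2_on U F"
  shows "\<exists>\<Sigma> :: (real^'m \<Rightarrow> real^'l) set. linear_maps_null \<Sigma> \<and>
    (\<forall>\<pi>\<in>{\<pi>. linear \<pi>} - \<Sigma>. C2_immersion A ((\<lambda>x. F x + \<pi> x) \<circ> f))"
proof -
  have atlas: "C2_atlas N A" and f: "C2_map A f"
    and inj_f: "\<And>V \<phi> p. (V, \<phi>) \<in> A \<Longrightarrow> p \<in> V
      \<Longrightarrow> inj (frechet_derivative (f \<circ> inv_into V \<phi>) (at (\<phi> p)))"
    using assms by (auto simp: C2_manifold_def C2_immersion_def)
  have charts: "is_chart N (V, \<phi>)" if "(V, \<phi>) \<in> A" for V \<phi>
    using that atlas by (auto simp: C2_atlas_def)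
  have fU: "(f \<circ> inv_into V \<phi>) ` (\<phi> ` V) \<subseteq> U" if "(V, \<phi>) \<in> A" for V \<phi>
  proof -
    have "V \<subseteq> topspace N"
      using charts[OF that] openin_subset by (auto simp: is_chart_def)
    then show ?thesis
      using assms(4) by (auto simp: is_chart_inv_into[OF charts[OF that]])
  qed
  have "Lindelof_space N"
    using assms(2) second_countable_imp_Lindelof_space by (auto simp: C2_manifold_def)
  moreover have "\<forall>V\<in>fst ` A. openin N V"
    using charts by (auto simp: is_chart_def)
  moreover have cover: "\<Union> (fst ` A) = topspace N"
    using atlas by (auto simp: C2_atlas_def case_prod_unfold)
  \<comment> \<open>Second countability yields a countable subcover, as null sets are closed only
    under countable unions.\<close>
  ultimately obtain \<V> where "countable \<V>" "\<V> \<subseteq> fst ` A" "\<Union> \<V> = topspace N"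
    unfolding Lindelof_space_def by meson
  then obtain B where B: "countable B" "B \<subseteq> A" "\<Union> (fst ` B) = topspace N"
    by (metis countable_subset_image)
  define bad :: "('a, real^'n) chart \<Rightarrow> (real^'m^'l) set" where
    "bad = (\<lambda>(V, \<phi>). {M. \<exists>x\<in>\<phi> ` V. \<not> inj (frechet_derivative
      ((\<lambda>y. F y + M *v y) \<circ> (f \<circ> inv_into V \<phi>)) (at x))})"
  have "negligible (bad c)" if "c \<in> B" for c
  proof -
    obtain V \<phi> where c: "c = (V, \<phi>)" by fastforce
    then have V: "(V, \<phi>) \<in> A" using B that by auto
    then have "C2_on (\<phi> ` V) (f \<circ> inv_into V \<phi>)"
      using f by (auto simp: C2_map_def)
    then show ?thesis
      unfolding c bad_def prod.case
      using V inj_f by (intro negligible_non_immersive_perturbations[OF assms(1,6) _ fU]) auto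
  qed
  then have neg: "negligible (\<Union>c\<in>B. bad c)"
    using B by (intro negligible_countable_Union) auto
  define \<Sigma> :: "(real^'m \<Rightarrow> real^'l) set" where "\<Sigma> = {\<pi>. linear \<pi> \<and> matrix \<pi> \<in> (\<Union>c\<in>B. bad c)}"
  have "negligible (matrix ` \<Sigma>)"
    using neg by (rule negligible_subset) (auto simp: \<Sigma>_def)
  then have "linear_maps_null \<Sigma>"
    by (auto simp: linear_maps_null_def \<Sigma>_def negligible_iff_null_sets)
  moreover have "C2_immersion A ((\<lambda>x. F x + \<pi> x) \<circ> f)" if \<pi>: "linear \<pi>" "\<pi> \<notin> \<Sigma>" for \<pi>
  proof -
    have C2: "C2_map A ((\<lambda>x. F x + \<pi> x) \<circ> f)"
      unfolding C2_map_def
    proof clarify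
      fix V \<phi> assume V: "(V, \<phi>) \<in> A"
      then have "C2_on (\<phi> ` V) (f \<circ> inv_into V \<phi>)"
        using f by (auto simp: C2_map_def)
      then show "C2_on (\<phi> ` V) ((\<lambda>x. F x + \<pi> x) \<circ> f \<circ> inv_into V \<phi>)"
        unfolding comp_assoc
        using C2_on_compose[OF C2_on_add[OF assms(6) C2_on_linear[OF \<pi>(1)]] _ fU[OF V]] by blast
    qed
    moreover have "inj (frechet_derivative ((\<lambda>x. F x + \<pi> x) \<circ> f \<circ> inv_into V \<phi>) (at (\<phi> p)))"
      if V: "(V, \<phi>) \<in> A" "p \<in> V" for V \<phi> p
    proof -
      \<comment> \<open>The given chart may lie outside \<open>B\<close>; injectivity is obtained in
        a chart of \<open>B\<close> around \<open>p\<close> and then transferred.\<close>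
      have "p \<in> topspace N" using V cover by force
      then obtain c where "c \<in> B" "p \<in> fst c"
        using B(3) by blast
      then obtain W \<psi> where W: "(W, \<psi>) \<in> B" "p \<in> W"
        by (cases c) auto
      have "matrix \<pi> \<notin> bad (W, \<psi>)" using \<pi> W by (auto simp: \<Sigma>_def)
      then have "inj (frechet_derivative ((\<lambda>x. F x + \<pi> x) \<circ> f \<circ> inv_into W \<psi>) (at (\<psi> p)))"
        using W matrix_vector_mul(2)[OF \<pi>(1)] by (auto simp: bad_def comp_assoc)
      then show ?thesis
        using inj_frechet_derivative_chart_change[OF atlas C2] V W B(2) by blast
    qed
    ultimately show ?thesis by (auto simp: C2_immersion_def)
  qed
  ultimately show ?thesis by blast
qed

end
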